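(* For every field $\mathbf{k}$ and every integer $n\ge 0$, $s_{\mathbf{k}}\chi(A_{\mathbf{k}^n})=n$.
   Context: Let $P\mathbf{k}^n$ be the set of $1$-dimensional subspaces of $\mathbf{k}^n$ and $\mathrm{Gr}_{n-1}(\mathbf{k}^n)$ the set of $(n-1)$-dimensional subspaces. The (simple undirected) graph $A_{\mathbf{k}^n}$ has vertex set $\{(U,V)\in P\mathbf{k}^n\times\mathrm{Gr}_{n-1}(\mathbf{k}^n)\mid U\not\subset V\}$, with $(U,V)$ and $(U',V')$ joined by an edge if and only if $U\subset V'$ and $U'\subset V$. An $n$-span colouring of a graph $G$ over $\mathbf{k}$ is a function assigning to each vertex $x$ a pair $(U_x,V_x)\in P\mathbf{k}^n\times\mathrm{Gr}_{n-1}(\mathbf{k}^n)$ such that $U_x\not\subset V_x$ for every vertex $x$, and $U_x\subset V_y$, $U_y\subset V_x$ for every edge $(x,y)$. The span chromatic number $s_{\mathbf{k}}\chi(G)$ is the least $n$ for which an $n$-span colouring of $G$ over $\mathbf{k}$ exists. *)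

theory Defs
  imports
    "HOL-Library.Extended_Nat"
    "Jordan_Normal_Form.VS_Connect"
    "Graph_Theory.Pair_Digraph"
begin

definition is_subspace :: "nat \<Rightarrow> 'k::field vec set \<Rightarrow> bool" where
  "is_subspace n W \<longleftrightarrow> VectorSpace.subspace class_ring W (module_vec TYPE('k) n)"

definition subspace_dim :: "nat \<Rightarrow> 'k::field vec set \<Rightarrow> nat" where
  "subspace_dim n W =
     vectorspace.dim class_ring ((module_vec TYPE('k) n) \<lparr>carrier := W\<rparr>)"

definition lines :: "nat \<Rightarrow> 'k::field vec set set" where
  "lines n = {U. is_subspace n U \<and> subspace_dim n U = 1}"

text \<open>Stated without truncated subtraction, so that there are no hyperplanes
  (subspaces of dimension \<open>-1\<close>) for \<open>n = 0\<close>.\<close>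

definition hyperplanes :: "nat \<Rightarrow> 'k::field vec set set" where
  "hyperplanes n = {V. is_subspace n V \<and> subspace_dim n V + 1 = n}"

text \<open>A simple undirected graph, possibly infinite, is represented by its vertices and
  its symmetric irreflexive adjacency relation (locale \<open>pair_bidirected_digraph\<close>).\<close>

definition span_graph ::
    "'k::field itself \<Rightarrow> nat \<Rightarrow> ('k vec set \<times> 'k vec set) pair_pre_digraph" where
  "span_graph _ n =
     (let X = {(U, V). U \<in> lines n \<and> V \<in> hyperplanes n \<and> \<not> U \<subseteq> V}
      in \<lparr> pverts = X,
           parcs = {((U, V), (U', V')).
             (U, V) \<in> X \<and> (U', V') \<in> X \<and> U \<subseteq> V' \<and> U' \<subseteq> V} \<rparr>)"

lemma span_graph_pair_bidirected_digraph:
  "pair_bidirected_digraph (span_graph TYPE('k::field) n)"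
proof unfold_locales
  show "symmetric (with_proj (span_graph TYPE('k) n))"
    by (auto simp: span_graph_def symmetric_def sym_def)
qed (auto simp: span_graph_def)

definition span_colouring ::
    "nat \<Rightarrow> 'v pair_pre_digraph \<Rightarrow> ('v \<Rightarrow> 'k::field vec set \<times> 'k vec set) \<Rightarrow> bool" where
  "span_colouring n G c \<longleftrightarrow>
     (\<forall>x \<in> pverts G. c x \<in> lines n \<times> hyperplanes n \<and> \<not> fst (c x) \<subseteq> snd (c x)) \<and>
     (\<forall>(x, y) \<in> parcs G. fst (c x) \<subseteq> snd (c y) \<and> fst (c y) \<subseteq> snd (c x))"

text \<open>The value is \<open>\<infinity>\<close> when \<open>G\<close> has no span colouring over the field in any
  dimension; this may happen for infinite graphs.\<close>

definition span_chromatic_number :: "'k::field itself \<Rightarrow> 'v pair_pre_digraph \<Rightarrow> enat" where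
  "span_chromatic_number _ G =
     Inf {enat n | n. \<exists>c :: 'v \<Rightarrow> 'k vec set \<times> 'k vec set. span_colouring n G c}"

lemma span_chromatic_number_eq_enat_iff:
  fixes G :: "'v pair_pre_digraph"
  defines "P \<equiv> \<lambda>n. \<exists>c :: 'v \<Rightarrow> 'k::field vec set \<times> 'k vec set. span_colouring n G c"
  shows "span_chromatic_number TYPE('k) G = enat n \<longleftrightarrow> P n \<and> (\<forall>m. P m \<longrightarrow> n \<le> m)"
proof -
  have eq: "span_chromatic_number TYPE('k) G = Inf (enat ` Collect P)"
    unfolding span_chromatic_number_def P_def by (rule arg_cong[where f = Inf]) auto
  show ?thesis
  proof
    assume *: "span_chromatic_number TYPE('k) G = enat n"
    have "enat ` Collect P \<noteq> {}"
      using * unfolding eq by (auto simp: Inf_enat_def split: if_splits)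
    then have "Inf (enat ` Collect P) \<in> enat ` Collect P"
      unfolding Inf_enat_def by (auto intro: LeastI)
    then have "P n" using * eq by auto
    moreover have "n \<le> m" if "P m" for m
    proof -
      have "Inf (enat ` Collect P) \<le> enat m" by (rule Inf_lower) (use that in auto)
      then show ?thesis using * eq by simp
    qed
    ultimately show "P n \<and> (\<forall>m. P m \<longrightarrow> n \<le> m)" by blast
  next
    assume *: "P n \<and> (\<forall>m. P m \<longrightarrow> n \<le> m)"
    show "span_chromatic_number TYPE('k) G = enat n"
      unfolding eq by (rule antisym) (use * in \<open>auto intro!: Inf_lower Inf_greatest\<close>)
  qed
qed

end

theory Submission
  imports Defs
begin

text \<open>The identity is an \<open>n\<close>-span colouring. Conversely, the coordinate lines paired with
  the complementary coordinate hyperplanes form a clique of size \<open>n\<close>. In any span colouring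
  of a clique choose \<open>u\<^sub>i \<in> U\<^sub>i\<close> outside \<open>V\<^sub>i\<close>: all the other \<open>u\<^sub>j\<close> lie in \<open>V\<^sub>i\<close>,
  so \<open>u\<^sub>i\<close> is not in their span, and the \<open>u\<^sub>i\<close> are \<open>n\<close> linearly independent vectors.\<close>

context vec_space
begin

text \<open>\<open>subspace_dim\<close> measures the span as a vector space of its own. Linear
  independence does not depend on the ambient space, so \<open>S\<close> is a basis of its
  span.\<close>

lemma subspace_dim_span:
  assumes "finite S" "S \<subseteq> carrier_vec n" "\<not> lin_dep S"
  shows "subspace_dim n (span S) = card S"
proof -
  let ?W = "V\<lparr>carrier := span S\<rparr>"
  have sub: "VectorSpace.subspace class_ring (span S) V"
    by (rule span_is_subspace[OF assms(2)])
  interpret W: vectorspace class_ring ?W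
    by (rule subspace_is_vs[OF sub])
  have own: "S \<subseteq> span S"
    by (rule in_own_span[OF assms(2)])
  have subm: "submodule class_ring (span S) V"
    by (rule span_is_submodule[OF assms(2)])
  have "W.basis S"
    unfolding W.basis_def
    using span_li_not_depend[OF own subm] assms(3) own by simp
  then show ?thesis
    unfolding subspace_dim_def using W.dim_basis assms(1) by blast
qed

lemma card_le_if_separated_by_subspaces:
  fixes u :: "'b \<Rightarrow> 'a vec"
  assumes I: "finite I"
    and u: "\<And>i. i \<in> I \<Longrightarrow> u i \<in> carrier_vec n"
    and W: "\<And>i. i \<in> I \<Longrightarrow> is_subspace n (W i)"
    and notin: "\<And>i. i \<in> I \<Longrightarrow> u i \<notin> W i"
    and mem: "\<And>i j. i \<in> I \<Longrightarrow> j \<in> I \<Longrightarrow> i \<noteq> j \<Longrightarrow> u j \<in> W i"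
  shows "card I \<le> n"
proof -
  have carr: "u ` I \<subseteq> carrier_vec n"
    using u by auto
  \<comment> \<open>If \<open>u i = u j\<close> with \<open>i\<close> and \<open>j\<close> distinct,
    then \<open>mem\<close> puts \<open>u i\<close> into \<open>W i\<close>, against
    \<open>notin\<close>.\<close>
  have inj: "inj_on u I"
    using notin mem by (metis inj_onI)
  have "\<not> lin_dep (u ` I)"
  proof
    assume "lin_dep (u ` I)"
    then obtain i where i: "i \<in> I" "u i \<in> span (u ` I - {u i})"
      using lindep_span[OF carr] I by blast
    have "u ` I - {u i} \<subseteq> W i"
      using mem i(1) by blast
    moreover have "submodule class_ring (W i) V"
      using W[OF i(1)] by (simp add: is_subspace_def VectorSpace.subspace_def)
    ultimately have "span (u ` I - {u i}) \<subseteq> W i"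
      by (rule span_is_subset)
    then show False
      using i notin by blast
  qed
  then have "card (u ` I) \<le> dim"
    using carr by (intro li_le_dim(2)) auto
  then show ?thesis
    by (simp add: card_image[OF inj] dim_is_n)
qed

text \<open>Indexing by sets treats lines (\<open>{i}\<close>) and hyperplanes
  (\<open>{..<n} - {i}\<close>) alike: dimension becomes cardinality and inclusions follow from
  inclusions of index sets.\<close>

definition coordinate_subspace :: "nat set \<Rightarrow> 'a vec set" where
  "coordinate_subspace I = span (unit_vec n ` I)"

lemma unit_vec_image_carrier: "unit_vec n ` I \<subseteq> carrier_vec n"
  by auto

lemma inj_on_unit_vec: "inj_on (unit_vec n :: nat \<Rightarrow> 'a vec) {..<n}"
  by (rule inj_onI) (auto simp: unit_vec_eq)

lemma unit_vecs_lin_indpt: "I \<subseteq> {..<n} \<Longrightarrow> \<not> lin_dep (unit_vec n ` I)"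
  using unit_vecs_basis unfolding basis_def unit_vecs_def
  by (elim conjE subset_li_is_li) auto

lemma is_subspace_coordinate_subspace: "is_subspace n (coordinate_subspace I)"
  unfolding is_subspace_def coordinate_subspace_def
  by (rule span_is_subspace[OF unit_vec_image_carrier])

lemma subspace_dim_coordinate_subspace:
  assumes "I \<subseteq> {..<n}"
  shows "subspace_dim n (coordinate_subspace I) = card I"
proof -
  have "finite I"
    using assms finite_subset by blast
  then have "subspace_dim n (coordinate_subspace I) = card (unit_vec n ` I :: 'a vec set)"
    unfolding coordinate_subspace_def
    using unit_vecs_lin_indpt[OF assms] by (intro subspace_dim_span) auto
  then show ?thesis
    using card_image[OF inj_on_subset[OF inj_on_unit_vec assms]] by simp
qed

lemma coordinate_subspace_mono:
  "I \<subseteq> J \<Longrightarrow> coordinate_subspace I \<subseteq> coordinate_subspace J"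
  unfolding coordinate_subspace_def by (intro span_is_monotone image_mono)

text \<open>Otherwise \<open>unit_vec n i\<close> would lie in the span of the other standard basis
  vectors, contradicting their independence.\<close>

lemma coordinate_line_not_subset:
  assumes "i < n"
  shows "\<not> coordinate_subspace {i} \<subseteq> coordinate_subspace ({..<n} - {i})"
proof
  let ?E = "unit_vec n ` {..<n} :: 'a vec set"
  assume le: "coordinate_subspace {i} \<subseteq> coordinate_subspace ({..<n} - {i})"
  have "unit_vec n i \<in> coordinate_subspace {i}"
    unfolding coordinate_subspace_def using in_own_span[OF unit_vec_image_carrier[of "{i}"]] by auto
  then have "unit_vec n i \<in> span (unit_vec n ` ({..<n} - {i}))"
    using le unfolding coordinate_subspace_def by blast
  \<comment> \<open>By injectivity, removing the index amounts to removing the vector, which is the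
    form that \<open>lindep_span\<close> speaks about.\<close>
  moreover have "unit_vec n ` ({..<n} - {i}) = ?E - {unit_vec n i}"
    using inj_on_image_set_diff[OF inj_on_unit_vec, of "{..<n}" "{i}"] assms by auto
  ultimately have "lin_dep ?E"
    using lindep_span[OF unit_vec_image_carrier] assms by auto
  then show False
    using unit_vecs_lin_indpt by blast
qed

lemma coordinate_pair_in_span_graph:
  assumes "i < n"
  shows "(coordinate_subspace {i}, coordinate_subspace ({..<n} - {i}))
    \<in> pverts (span_graph TYPE('a) n)"
  using assms coordinate_line_not_subset
  by (auto simp: span_graph_def lines_def hyperplanes_def is_subspace_coordinate_subspace
      subspace_dim_coordinate_subspace)

text \<open>For distinct indices, \<open>{i}\<close> avoids \<open>j\<close> and \<open>{j}\<close>
  avoids \<open>i\<close>, so monotonicity gives both inclusions of an edge.\<close>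

lemma coordinate_pairs_adjacent:
  assumes "i < n" "j < n" "i \<noteq> j"
  shows "((coordinate_subspace {i}, coordinate_subspace ({..<n} - {i})),
      (coordinate_subspace {j}, coordinate_subspace ({..<n} - {j})))
    \<in> parcs (span_graph TYPE('a) n)"
  using coordinate_pair_in_span_graph[OF assms(1)] coordinate_pair_in_span_graph[OF assms(2)]
    coordinate_subspace_mono[of "{i}" "{..<n} - {j}"]
    coordinate_subspace_mono[of "{j}" "{..<n} - {i}"] assms
  by (auto simp: span_graph_def)

end

lemma clique_card_le_if_span_colouring:
  fixes c :: "'v \<Rightarrow> 'k::field vec set \<times> 'k vec set"
  assumes c: "span_colouring m G c"
    and I: "finite I"
    and vert: "\<And>i. i \<in> I \<Longrightarrow> x i \<in> pverts G"
    and adj: "\<And>i j. i \<in> I \<Longrightarrow> j \<in> I \<Longrightarrow> i \<noteq> j \<Longrightarrow> (x i, x j) \<in> parcs G"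
  shows "card I \<le> m"
proof -
  \<comment> \<open>The independent vectors live in the space of the colours, so the bound is its
    dimension \<open>m\<close>.\<close>
  interpret vec_space "TYPE('k)" m .
  have col: "fst (c (x i)) \<in> lines m \<and> snd (c (x i)) \<in> hyperplanes m
      \<and> \<not> fst (c (x i)) \<subseteq> snd (c (x i))" if "i \<in> I" for i
    using c vert[OF that] by (auto simp: span_colouring_def mem_Times_iff)
  have "\<exists>v. v \<in> fst (c (x i)) \<and> v \<notin> snd (c (x i))" if "i \<in> I" for i
    using col[OF that] by blast
  then obtain u where u: "\<And>i. i \<in> I \<Longrightarrow> u i \<in> fst (c (x i)) \<and> u i \<notin> snd (c (x i))"
    by metis
  show ?thesis
  proof (rule card_le_if_separated_by_subspaces[OF I, of u "\<lambda>i. snd (c (x i))"])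
    fix i assume i: "i \<in> I"
    have "fst (c (x i)) \<subseteq> carrier_vec m"
      using col[OF i]
      by (simp add: lines_def is_subspace_def VectorSpace.subspace_def submodule_def)
    then show "u i \<in> carrier_vec m"
      using u[OF i] by auto
    show "is_subspace m (snd (c (x i)))"
      using col[OF i] by (simp add: hyperplanes_def)
    show "u i \<notin> snd (c (x i))"
      using u[OF i] by simp
  next
    \<comment> \<open>The edge between \<open>x i\<close> and \<open>x j\<close> places the whole
      line of \<open>x j\<close>, hence \<open>u j\<close>, in the hyperplane of
      \<open>x i\<close>.\<close>
    fix i j assume "i \<in> I" "j \<in> I" "i \<noteq> j"
    then have "fst (c (x j)) \<subseteq> snd (c (x i))"
      using c adj by (fastforce simp: span_colouring_def)
    then show "u j \<in> snd (c (x i))"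
      using u \<open>j \<in> I\<close> by blast
  qed
qed

text \<open>The upper bound: the conditions on a colouring are those defining the vertices and edges
  of this graph.\<close>

lemma span_colouring_span_graph_id: "span_colouring n (span_graph TYPE('k::field) n) id"
  by (auto simp: span_colouring_def span_graph_def)

theorem proposition4p9:
  fixes n :: nat
  shows "span_chromatic_number TYPE('k::field) (span_graph TYPE('k) n) = enat n"
  unfolding span_chromatic_number_eq_enat_iff
proof (intro conjI allI impI)
  show "\<exists>c :: _ \<Rightarrow> 'k vec set \<times> 'k vec set. span_colouring n (span_graph TYPE('k) n) c"
    using span_colouring_span_graph_id by blast
next
  fix m
  assume "\<exists>c :: _ \<Rightarrow> 'k vec set \<times> 'k vec set. span_colouring m (span_graph TYPE('k) n) c"
  then obtain c :: "'k vec set \<times> 'k vec set \<Rightarrow> 'k vec set \<times> 'k vec set"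
    where c: "span_colouring m (span_graph TYPE('k) n) c" ..
  \<comment> \<open>The clique lives in dimension \<open>n\<close>, its colours in dimension
    \<open>m\<close>. For \<open>n = 0\<close> the clique is empty and the bound is trivial.\<close>
  interpret vec_space "TYPE('k)" n .
  have "card {..<n} \<le> m"
    using coordinate_pair_in_span_graph coordinate_pairs_adjacent
    by (intro clique_card_le_if_span_colouring[OF c,
          where x = "\<lambda>i. (coordinate_subspace {i}, coordinate_subspace ({..<n} - {i}))"]) auto
  then show "n \<le> m"
    by simp
qed

end
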